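(* Assume $Y=X\beta_\star+\epsilon$ with $\epsilon\sim N(0,\sigma_\star^2 I_n)$, where $\sigma_\star^2>0$ is known. Assume $X\in\mathbb R^{n\times p}$ has nonzero, pairwise orthogonal columns $x_1,\dots,x_p$. Let $s=|\{j:\beta_{\star,j}\neq0\}|$ and assume $\log s\ge 1$. Fix a constant $c_0>2$ and set $z_\star=c_0\log p$. Let $\tilde\beta_n$ be the thresholded SBL estimator defined below. Then \[\|\tilde\beta_n-\beta_\star\|_2^2\le M\,\frac{\sigma_\star^2\, s\log p}{n}\] with probability at least $1-p^{-c_0 s/8}-e^{-s}$, where $M=\frac{4(2+c_0)}{c}$ and $c=\min_{1\le j\le p}\|x_j\|^2/n$.
   Context: Here $\sigma^2=\sigma_\star^2$ throughout. For $\gamma\in[0,\infty)^p$ let $I_\gamma=\{j:\gamma_j\neq0\}$, and define $C_\gamma=\sigma^2 I_n+\sum_{j\in I_\gamma}\gamma_j x_jx_j'$ and $\ell(\sigma^2,\gamma)=-\tfrac12\log\det(C_\gamma)-\tfrac12\operatorname{Tr}(C_\gamma^{-1}YY')$. SBL hyperparameter estimate: $\hat\gamma_n$ is a maximizer of $\gamma\mapsto\ell(\sigma^2,\gamma)$ over $[0,\infty)^p$. Under the orthogonality assumption it is given by $\hat\gamma_{n,j}=(\langle x_j,Y\rangle^2-\sigma^2\|x_j\|^2)/\|x_j\|^4$ if $\langle x_j,Y\rangle^2>\sigma^2\|x_j\|^2$, and $\hat\gamma_{n,j}=0$ otherwise. Thresholded version: $\tilde\gamma_{n,j}=\hat\gamma_{n,j}$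 if $\hat\gamma_{n,j}>\sigma^2 z_\star/\|x_j\|^2$, and $\tilde\gamma_{n,j}=0$ otherwise. Estimator (posterior mean): for $\gamma\in[0,\infty)^p$, the posterior mean $\mu_\gamma\in\mathbb R^p$ has $\mu_{\gamma,j}=0$ for $j\notin I_\gamma$, and $(\mu_{\gamma,j})_{j\in I_\gamma}=(X_\gamma'X_\gamma+\sigma^2\bar\Gamma_\gamma^{-1})^{-1}X_\gamma'Y$. Here $X_\gamma$ is the submatrix of columns of $X$ indexed by $I_\gamma$, and $\bar\Gamma_\gamma=\operatorname{diag}(\gamma_j, j\in I_\gamma)$. Finally, $\tilde\beta_n=\mu_{\tilde\gamma_n}$. *)

theory Defs
  imports "HOL-Analysis.Analysis" "HOL-Probability.Probability"
begin

text \<open>SBL hyperparameter estimate (closed form under orthogonal columns).\<close>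
definition sbl_gamma_hat :: "real \<Rightarrow> real^'p^'n \<Rightarrow> real^'n \<Rightarrow> real^'p" where
  "sbl_gamma_hat sigma2 X Y = (\<chi> j.
     if (column j X \<bullet> Y)^2 > sigma2 * (norm (column j X))^2
     then ((column j X \<bullet> Y)^2 - sigma2 * (norm (column j X))^2) / (norm (column j X))^4
     else 0)"

definition sbl_gamma_tilde :: "real \<Rightarrow> real \<Rightarrow> real^'p^'n \<Rightarrow> real^'n \<Rightarrow> real^'p" where
  "sbl_gamma_tilde sigma2 zstar X Y = (\<chi> j.
     if sbl_gamma_hat sigma2 X Y $ j > sigma2 * zstar / (norm (column j X))^2
     then sbl_gamma_hat sigma2 X Y $ j else 0)"

text \<open>Posterior mean mu_gamma.  Writing I = I_gamma, the vector (mu_j)_{j in I} equals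
  (X_I' X_I + sigma2 Gamma_I^{-1})^{-1} X_I' Y and mu_j = 0 off I.  This is encoded by
  inverting the p x p block-diagonal matrix whose I x I block is X_I' X_I + sigma2 Gamma_I^{-1}
  and whose complementary block is the identity, applied to the vector that equals X' Y on I
  and 0 off I (block-diagonal inverse = blockwise inverse).\<close>
definition post_mean :: "real \<Rightarrow> real^'p^'n \<Rightarrow> real^'p \<Rightarrow> real^'n \<Rightarrow> real^'p" where
  "post_mean sigma2 X gamma Y =
     (let I = {j. gamma $ j \<noteq> 0};
          A = (\<chi> j k. if j \<in> I \<and> k \<in> I
                      then (transpose X ** X) $ j $ k + (if j = k then sigma2 / gamma $ j else 0)
                      else (if j = k then 1 else 0));
          b = (\<chi> j. if j \<in> I then (transpose X *v Y) $ j else 0)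
      in matrix_inv A *v b)"

definition sbl_beta_tilde :: "real \<Rightarrow> real \<Rightarrow> real^'p^'n \<Rightarrow> real^'n \<Rightarrow> real^'p" where
  "sbl_beta_tilde sigma2 zstar X Y = post_mean sigma2 X (sbl_gamma_tilde sigma2 zstar X Y) Y"

end

theory Submission
  imports Defs
begin

text \<open>
  By orthogonality the estimator acts coordinatewise. Put W_j = <x_j, eps> / (sigma |x_j|),
  theta_j = |x_j| beta_j / sigma and z = c0 log p. The j-th error is sigma / |x_j| times
  e_j = T(theta_j + W_j) - theta_j, where T(u) = u - 1/u if u^2 > 1 + z and T(u) = 0 otherwise, so it
  suffices to bound the sum of the e_j^2 by 4 (2 + c0) s log p. The W_j are independent standard
  normal, by rotation invariance of the Gaussian law.

  On the support, e_j^2 \<le> 2 W_j^2 + 2 (1 + z), and by Chernoff with parameter 1/4 the sum of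
  the W_j^2 exceeds s (z/2 + 2 log 2) with probability at most p^(-c0 s/8). Off the support, e_j^2 \<le> W_j^2 - 1 if W_j^2 > 1 + z and
  e_j = 0 otherwise. Since c0 > 2, the expected number of such exceedances is bounded, but it need
  not decay polynomially in p, so the Chernoff parameter must be of order 1/z. With parameter exactly
  1/z the remaining budget s (z + 8 log p - 2 - 4 log 2) is exceeded with probability at most exp(-s).
\<close>

text \<open>
  The change of variables theorems of the library need a well-ordered index type, whereas the
  coordinates here are indexed by an arbitrary finite type; this copy supplies the order.
\<close>

typedef 'n ordered_index = "UNIV :: 'n set" ..

lemma bij_Rep_ordered_index: "bij (Rep_ordered_index :: 'n ordered_index \<Rightarrow> 'n)"
  by (metis Abs_ordered_index_inverse Rep_ordered_index_inverse UNIV_I bij_betw_def injI surjI)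

instantiation ordered_index :: (finite) wellorder
begin

text \<open>On a finite type \<open>to_nat_on UNIV\<close> is injective, so pulling back the order
  of the naturals gives a linear order, and well-founded induction carries over.\<close>

definition "i \<le> k \<longleftrightarrow> to_nat_on UNIV (Rep_ordered_index i) \<le> to_nat_on UNIV (Rep_ordered_index k)"

definition "i < k \<longleftrightarrow> to_nat_on UNIV (Rep_ordered_index i) < to_nat_on UNIV (Rep_ordered_index k)"

instance
proof (standard, goal_cases)
  case (4 i k)
  then show ?case
    by (simp add: less_eq_ordered_index_def Rep_ordered_index_inject uncountable_infinite)
next
  case (6 P i)
  show ?case
    by (induction i rule: measure_induct_rule [where f = "\<lambda>i. to_nat_on UNIV (Rep_ordered_index i)"])
      (rule 6, simp add: less_ordered_index_def)
qed (auto simp: less_eq_ordered_index_def less_ordered_index_def)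

end

instance ordered_index :: (finite) finite
proof
  show "finite (UNIV :: 'a ordered_index set)"
    using bij_Rep_ordered_index bij_betw_finite finite_class.finite_UNIV by blast
qed

section \<open>Orthogonal maps, orthonormal families and Lebesgue measure\<close>

text \<open>Lebesgue measure is determined by its values on boxes. The preimage of a box under
  \<open>T\<close> is its image under the orthogonal map \<open>inv T\<close>, and orthogonal images
  preserve measure.\<close>

lemma lborel_distr_orthogonal_transformation:
  fixes T :: "real^'n::{finite,wellorder} \<Rightarrow> real^'n::_"
  assumes T: "orthogonal_transformation T"
  shows "distr lborel borel T = lborel"
proof (rule lborel_eqI [symmetric])
  fix l u :: "(real, 'n) vec" assume lu: "\<And>b. b \<in> Basis \<Longrightarrow> l \<bullet> b \<le> u \<bullet> b"
  have bT: "bij T"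
    using T by (rule orthogonal_transformation_bij)
  have oT: "orthogonal_transformation (inv T)"
    using T by (rule orthogonal_transformation_inv)
  have [measurable]: "T \<in> borel_measurable borel"
    using T by (intro borel_measurable_continuous_onI linear_continuous_on linear_conv_bounded_linear[THEN iffD1]
        orthogonal_transformation_linear)
  have vi: "T -` box l u = inv T ` box l u"
    by (rule bij_vimage_eq_inv_image [OF bT])
  have fin: "inv T ` box l u \<in> lmeasurable"
    by (intro measurable_orthogonal_image oT lmeasurable_box)
  have meas: "T -` box l u \<in> sets lborel"
    using measurable_sets [of T lborel borel "box l u"] by simp
  have "emeasure (distr lborel borel T) (box l u) = emeasure lebesgue (inv T ` box l u)"
    using meas by (simp add: emeasure_distr vi)
  also have "\<dots> = measure lebesgue (box l u)"
    using fin by (simp add: emeasure_eq_measure2 measure_orthogonal_image [OF oT])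
  also have "\<dots> = emeasure lborel (box l u)"
    using emeasure_lborel_box_finite [of l u]
    by (simp add: emeasure_eq_ennreal_measure [of lborel] less_top)
  also have "\<dots> = (\<Prod>b\<in>Basis. (u - l) \<bullet> b)"
    using lu by (simp add: emeasure_lborel_box)
  finally show "emeasure (distr lborel borel T) (box l u) = (\<Prod>b\<in>Basis. (u - l) \<bullet> b)" .
qed simp

text \<open>The family is extended to an orthogonal basis of the whole space; the normalised basis
  vectors become the columns of \<open>A\<close>. Normalising leaves each \<open>u j\<close>
  unchanged, and \<open>g\<close> records the column where it sits.\<close>

lemma orthonormal_family_extend:
  fixes u :: "'p::finite \<Rightarrow> real^'n"
  assumes norm: "\<And>j. norm (u j) = 1"
    and orth: "\<And>j k. j \<noteq> k \<Longrightarrow> u j \<bullet> u k = 0"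
  obtains A :: "real^'n^'n" and g :: "'p \<Rightarrow> 'n"
  where "orthogonal_matrix A" "inj g" "\<And>j. column (g j) A = u j"
proof -
  have inj: "inj u"
  proof (rule injI, rule ccontr)
    fix j k assume "u j = u k" "j \<noteq> k"
    then have "u j \<bullet> u j = 0" using orth[of j k] by simp
    then show False using norm[of j] by simp
  qed
  have "pairwise orthogonal (range u)"
    using orth unfolding pairwise_def orthogonal_def by (metis rangeE)
  then obtain U where U: "U \<inter> insert 0 (range u) = {}" "pairwise orthogonal (range u \<union> U)"
      "span (range u \<union> U) = span (range u \<union> UNIV)"
    by (rule orthogonal_extension_strong [where T = UNIV])
  define S where "S = range u \<union> U"
  have "0 \<notin> S"
    using U(1) norm unfolding S_def by (metis Int_iff UnE empty_iff insertI1 norm_zero rangeE zero_neq_one)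
  then have ind: "independent S"
    using U(2) by (simp add: S_def pairwise_orthogonal_independent)
  have "span S = UNIV"
    using U(3) by (simp add: S_def)
  \<comment> \<open>An independent spanning set has as many elements as the dimension, so the basis
    can be indexed by \<open>'n\<close> itself and \<open>A\<close> is square.\<close>
  then have "card S = CARD('n)"
    using ind by (metis dim_UNIV dim_eq_card dim_span DIM_cart DIM_real mult.right_neutral)
  moreover have "finite S"
    using ind by (rule independent_imp_finite)
  ultimately obtain f where f: "bij_betw f (UNIV::'n set) S"
    by (metis finite_class.finite_UNIV finite_same_card_bij)
  define A :: "real^'n^'n" where "A = (\<chi> i k. (f k /\<^sub>R norm (f k)) $ i)"
  have col: "column k A = f k /\<^sub>R norm (f k)" for k
    by (simp add: A_def column_def vec_eq_iff)
  have fS: "f k \<in> S" for k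
    using f by (auto simp: bij_betw_def)
  have f0: "f k \<noteq> 0" for k
    using fS[of k] \<open>0 \<notin> S\<close> by metis
  have fo: "orthogonal (f k) (f l)" if "k \<noteq> l" for k l
    using U(2) fS[of k] fS[of l] f that unfolding S_def [symmetric]
    by (auto simp: pairwise_def bij_betw_def inj_on_def)
  show thesis
  proof
    show "orthogonal_matrix A"
      using f0 fo by (simp add: orthogonal_matrix_orthonormal_columns col orthogonal_clauses)
    have uS: "u j \<in> f ` UNIV" for j
      unfolding bij_betw_imp_surj_on [OF f] by (simp add: S_def)
    have fg: "f (inv f (u j)) = u j" for j
      using uS by (simp add: f_inv_into_f)
    show "inj (\<lambda>j. inv f (u j))"
    proof (rule injI)
      fix j k assume "inv f (u j) = inv f (u k)"
      then have "u j = u k" by (metis fg)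
      then show "j = k" using inj by (simp add: inj_eq)
    qed
    show "column (inv f (u j)) A = u j" for j
      by (simp add: col fg norm)
  qed
qed

text \<open>This is the product formula over \<open>Basis\<close>, rewritten over coordinates
  through the bijection between indices and axis vectors.\<close>

lemma nn_integral_lborel_vec_prod:
  fixes f :: "'n::finite \<Rightarrow> real \<Rightarrow> ennreal"
  assumes [measurable]: "\<And>i. f i \<in> borel_measurable borel"
  shows "(\<integral>\<^sup>+x. (\<Prod>i\<in>UNIV. f i (x $ i)) \<partial>(lborel :: (real^'n) measure)) = (\<Prod>i\<in>UNIV. \<integral>\<^sup>+x. f i x \<partial>lborel)"
proof -
  let ?ax = "\<lambda>i. axis i 1 :: real^'n"
  have inj: "inj ?ax"
    by (auto intro!: injI simp: axis_eq_axis)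
  have B: "(Basis :: (real^'n) set) = range ?ax"
    by (auto simp: Basis_vec_def)
  have *: "(\<Prod>b\<in>Basis. G b) = (\<Prod>i\<in>UNIV. G (?ax i))" for G :: "real^'n \<Rightarrow> ennreal"
    unfolding B by (subst prod.reindex) (use inj in \<open>auto simp: inj_on_def\<close>)
  have [simp]: "inv ?ax (?ax i) = i" for i
    by (rule inv_f_f [OF inj])
  show ?thesis
    using nn_integral_lborel_prod [of "\<lambda>b. f (inv ?ax b)"]
    by (simp add: * inner_axis)
qed

lemma vec_nth_measurable [measurable]: "(\<lambda>x :: real^'n. x $ i) \<in> borel_measurable borel"
  by (intro borel_measurable_continuous_onI continuous_intros)

lemma borel_measurable_vecI:
  fixes f :: "'a \<Rightarrow> real^'n"
  assumes "\<And>i. (\<lambda>x. f x $ i) \<in> borel_measurable M"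
  shows "f \<in> borel_measurable M"
  by (rule borel_measurable_euclidean_space [THEN iffD2]) (use assms in \<open>auto simp: Basis_vec_def inner_axis\<close>)

section \<open>Joint law of a standard Gaussian vector along orthonormal directions\<close>

context prob_space
begin

text \<open>Open boxes form an intersection-stable generator. The indicator of a box is a product
  over coordinates, so independence factorises its probability and Tonelli reassembles the
  factors.\<close>

lemma std_normal_vec_distr:
  fixes \<epsilon> :: "'a \<Rightarrow> real^'n"
  assumes indep: "indep_vars (\<lambda>_. borel) (\<lambda>i \<omega>. \<epsilon> \<omega> $ i) UNIV"
    and dist: "\<And>i. distributed M lborel (\<lambda>\<omega>. \<epsilon> \<omega> $ i) std_normal_density"
  shows "distr M borel \<epsilon> = density lborel (\<lambda>x. \<Prod>i\<in>UNIV. ennreal (std_normal_density (x $ i)))"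
    (is "_ = ?D")
proof -
  have mi [measurable]: "(\<lambda>\<omega>. \<epsilon> \<omega> $ i) \<in> borel_measurable M" for i
    using indep by (auto simp: indep_vars_def)
  then have m [measurable]: "\<epsilon> \<in> borel_measurable M"
    by (rule borel_measurable_vecI)
  have box: "emeasure (distr M borel \<epsilon>) (box l u) = emeasure ?D (box l u)" for l u
  proof -
    let ?I = "\<lambda>i x. indicator {l $ i<..<u $ i} x :: ennreal"
    have ind: "indicator (box l u) x = (\<Prod>i\<in>UNIV. ?I i (x $ i))" for x
      by (auto simp: indicator_def mem_box_cart)
    have "emeasure (distr M borel \<epsilon>) (box l u) = (\<integral>\<^sup>+x. indicator (box l u) x \<partial>distr M borel \<epsilon>)"
      by simp
    also have "\<dots> = (\<integral>\<^sup>+\<omega>. (\<Prod>i\<in>UNIV. ?I i (\<epsilon> \<omega> $ i)) \<partial>M)"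
      by (subst nn_integral_distr) (auto simp: ind)
    also have "\<dots> = (\<Prod>i\<in>UNIV. \<integral>\<^sup>+\<omega>. ?I i (\<epsilon> \<omega> $ i) \<partial>M)"
      by (intro indep_vars_nn_integral indep_vars_compose2 [OF indep]) auto
    also have "\<dots> = (\<Prod>i\<in>UNIV. \<integral>\<^sup>+x. ennreal (std_normal_density x) * ?I i x \<partial>lborel)"
      by (intro prod.cong refl distributed_nn_integral [OF dist, symmetric]) auto
    also have "\<dots> = (\<integral>\<^sup>+x. (\<Prod>i\<in>UNIV. ennreal (std_normal_density (x $ i)) * ?I i (x $ i)) \<partial>(lborel :: (real^'n) measure))"
      by (subst nn_integral_lborel_vec_prod) auto
    also have "\<dots> = emeasure ?D (box l u)"
      by (subst emeasure_density) (auto simp: ind prod.distrib)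
    finally show ?thesis .
  qed
  show ?thesis
  proof (rule measure_eqI_generator_eq)
    let ?E = "range (\<lambda>(a, b). box a b::(real^'n) set)"
    show "Int_stable ?E"
      by (auto simp: Int_stable_def box_Int_box)
    show "?E \<subseteq> Pow UNIV" by simp
    show "sets (distr M borel \<epsilon>) = sigma_sets UNIV ?E" "sets ?D = sigma_sets UNIV ?E"
      by (simp_all add: borel_eq_box)
    let ?A = "\<lambda>n::nat. box (- (real n *\<^sub>R One)) (real n *\<^sub>R One) :: (real^'n) set"
    show "range ?A \<subseteq> ?E" by auto
    show "(\<Union>i. ?A i) = UNIV"
      by (rule UN_box_eq_UNIV)
    interpret P: prob_space "distr M borel \<epsilon>"
      by (rule prob_space_distr) simp
    show "emeasure (distr M borel \<epsilon>) (?A i) \<noteq> \<infinity>" for i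
      by simp
  qed (use box in auto)
qed

text \<open>This expresses that the projections \<open>u j \<bullet> \<epsilon>\<close> are
  independent standard normals. Substituting \<open>A *v x\<close> for \<open>x\<close> preserves
  both Lebesgue measure and the Gaussian density, and turns \<open>u j \<bullet> x\<close> into the
  coordinate \<open>x $ g j\<close>.\<close>

lemma nn_integral_std_normal_orthonormal_wellorder:
  fixes \<epsilon> :: "'a \<Rightarrow> real^'n::{finite,wellorder}" and u :: "'p::finite \<Rightarrow> real^'n::_"
    and f :: "'p \<Rightarrow> real \<Rightarrow> ennreal"
  assumes indep: "indep_vars (\<lambda>_. borel) (\<lambda>i \<omega>. \<epsilon> \<omega> $ i) UNIV"
    and dist: "\<And>i. distributed M lborel (\<lambda>\<omega>. \<epsilon> \<omega> $ i) std_normal_density"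
    and norm: "\<And>j. norm (u j) = 1"
    and orth: "\<And>j k. j \<noteq> k \<Longrightarrow> u j \<bullet> u k = 0"
    and [measurable]: "\<And>j. f j \<in> borel_measurable borel"
  shows "(\<integral>\<^sup>+\<omega>. (\<Prod>j\<in>UNIV. f j (u j \<bullet> \<epsilon> \<omega>)) \<partial>M)
    = (\<Prod>j\<in>UNIV. \<integral>\<^sup>+x. ennreal (std_normal_density x) * f j x \<partial>lborel)"
proof -
  let ?\<phi> = "\<lambda>x. ennreal (std_normal_density x)"
  have mi [measurable]: "(\<lambda>\<omega>. \<epsilon> \<omega> $ i) \<in> borel_measurable M" for i
    using indep by (auto simp: indep_vars_def)
  then have m [measurable]: "\<epsilon> \<in> borel_measurable M"
    by (rule borel_measurable_vecI)
  obtain A :: "((real, 'n) vec, 'n) vec" and g :: "'p \<Rightarrow> 'n"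
    where A: "orthogonal_matrix A" and g: "inj g" and col: "\<And>j. column (g j) A = u j"
    by (rule orthonormal_family_extend [OF norm orth]) auto
  have T: "orthogonal_transformation ((*v) A)"
    using A by (simp add: orthogonal_transformation_matrix)
  have [measurable]: "(*v) A \<in> borel_measurable borel"
    by (intro borel_measurable_continuous_onI linear_continuous_on) simp
  have uA: "u j \<bullet> (A *v x) = x $ g j" for j x
  proof -
    have "u j \<bullet> (A *v x) = (transpose A *v (A *v x)) $ g j"
      by (simp add: col [symmetric] matrix_vector_mult_def transpose_def column_def inner_vec_def)
    also have "\<dots> = x $ g j"
      using A by (simp add: matrix_vector_mul_assoc orthogonal_matrix)
    finally show ?thesis .
  qed
  \<comment> \<open>The joint density depends on \<open>x\<close> only through its norm, which is
    what makes it invariant under \<open>A\<close> in \<open>rot\<close>.\<close>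
  have dens: "(\<Prod>i\<in>UNIV. ?\<phi> (x $ i)) = ennreal ((1 / sqrt (2 * pi)) ^ CARD('n) * exp (- (norm x)\<^sup>2 / 2))"
    for x :: "(real, 'n) vec"
    by (simp add: prod_ennreal std_normal_density_def prod_dividef exp_sum [symmetric] power_divide
        norm_vec_def L2_set_def sum_nonneg sum_divide_distrib sum_negf)
  have rot: "(\<Prod>i\<in>UNIV. ?\<phi> ((A *v x) $ i)) = (\<Prod>i\<in>UNIV. ?\<phi> (x $ i))" for x
    using T by (simp add: dens orthogonal_transformation_norm)
  \<comment> \<open>Coordinates outside the range of \<open>g\<close> receive the factor 1; their
    integrals are the total mass of the normal density and so drop out of the product.\<close>
  define F where "F i = (if i \<in> range g then f (inv g i) else (\<lambda>_. 1))" for i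
  have [measurable]: "F i \<in> borel_measurable borel" for i
    by (simp add: F_def)
  have split: "(\<Prod>i\<in>UNIV. H i) = (\<Prod>j\<in>UNIV. H (g j))" if "\<And>i. i \<notin> range g \<Longrightarrow> H i = 1" for H :: "'n \<Rightarrow> ennreal"
  proof -
    have "(\<Prod>i\<in>UNIV. H i) = (\<Prod>i\<in>range g. H i)"
      by (rule prod.mono_neutral_right) (use that in auto)
    also have "\<dots> = (\<Prod>j\<in>UNIV. H (g j))"
      using g by (simp add: prod.reindex)
    finally show ?thesis .
  qed
  have F: "(\<Prod>i\<in>UNIV. F i (x $ i)) = (\<Prod>j\<in>UNIV. f j (x $ g j))" for x
    using g by (subst split) (auto simp: F_def)
  have "(\<integral>\<^sup>+\<omega>. (\<Prod>j\<in>UNIV. f j (u j \<bullet> \<epsilon> \<omega>)) \<partial>M) = (\<integral>\<^sup>+x. (\<Prod>j\<in>UNIV. f j (u j \<bullet> x)) \<partial>distr M borel \<epsilon>)"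
    by (subst nn_integral_distr) auto
  also have "\<dots> = (\<integral>\<^sup>+x. (\<Prod>i\<in>UNIV. ?\<phi> (x $ i)) * (\<Prod>j\<in>UNIV. f j (u j \<bullet> x)) \<partial>distr lborel borel ((*v) A))"
    by (simp add: std_normal_vec_distr [OF indep dist] nn_integral_density
        lborel_distr_orthogonal_transformation [OF T])
  also have "\<dots> = (\<integral>\<^sup>+x. (\<Prod>i\<in>UNIV. ?\<phi> (x $ i)) * (\<Prod>j\<in>UNIV. f j (x $ g j)) \<partial>lborel)"
    by (subst nn_integral_distr) (auto simp: rot uA)
  also have "\<dots> = (\<integral>\<^sup>+x. (\<Prod>i\<in>UNIV. ?\<phi> (x $ i) * F i (x $ i)) \<partial>lborel)"
    by (simp add: prod.distrib F)
  also have "\<dots> = (\<Prod>i\<in>UNIV. \<integral>\<^sup>+x. ?\<phi> x * F i x \<partial>lborel)"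
    by (subst nn_integral_lborel_vec_prod) auto
  also have "\<dots> = (\<Prod>j\<in>UNIV. \<integral>\<^sup>+x. ?\<phi> x * f j x \<partial>lborel)"
    using g by (subst split) (auto simp: F_def nn_integral_eq_integral)
  finally show ?thesis .
qed

text \<open>Needed to carry the independence of the noise coordinates over to the ordered copy of
  the index type.\<close>

lemma indep_vars_reindex:
  assumes g: "inj_on g I" and indep: "indep_vars M' X (g ` I)"
  shows "indep_vars (\<lambda>i. M' (g i)) (\<lambda>i. X (g i)) I"
  unfolding indep_vars_def2
proof (intro conjI ballI indep_setsI)
  show "random_variable (M' (g i)) (X (g i))" if "i \<in> I" for i
    using indep that by (auto simp: indep_vars_def2)
  show "{X (g i) -` A \<inter> space M |A. A \<in> sets (M' (g i))} \<subseteq> events" if "i \<in> I" for i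
    using indep that by (auto simp: indep_vars_def2 indep_sets_def)
  fix A J assume J: "J \<noteq> {}" "J \<subseteq> I" "finite J"
    and A: "\<forall>j\<in>J. A j \<in> {X (g j) -` A \<inter> space M |A. A \<in> sets (M' (g j))}"
  have inj: "inj_on g J"
    using g J(2) by (rule inj_on_subset)
  have "prob (\<Inter>k\<in>g ` J. A (inv_into J g k)) = (\<Prod>k\<in>g ` J. prob (A (inv_into J g k)))"
    by (rule indep_setsD [where I = "g ` I"]) (use indep J A inj in \<open>auto simp: indep_vars_def2\<close>)
  then show "prob (\<Inter>j\<in>J. A j) = (\<Prod>j\<in>J. prob (A j))"
    using inj by (simp add: prod.reindex)
qed

lemma nn_integral_std_normal_orthonormal:
  fixes \<epsilon> :: "'a \<Rightarrow> real^'n" and u :: "'p::finite \<Rightarrow> real^'n"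
    and f :: "'p \<Rightarrow> real \<Rightarrow> ennreal"
  assumes indep: "indep_vars (\<lambda>_. borel) (\<lambda>i \<omega>. \<epsilon> \<omega> $ i) UNIV"
    and dist: "\<And>i. distributed M lborel (\<lambda>\<omega>. \<epsilon> \<omega> $ i) std_normal_density"
    and norm: "\<And>j. norm (u j) = 1"
    and orth: "\<And>j k. j \<noteq> k \<Longrightarrow> u j \<bullet> u k = 0"
    and meas: "\<And>j. f j \<in> borel_measurable borel"
  shows "(\<integral>\<^sup>+\<omega>. (\<Prod>j\<in>UNIV. f j (u j \<bullet> \<epsilon> \<omega>)) \<partial>M)
    = (\<Prod>j\<in>UNIV. \<integral>\<^sup>+x. ennreal (std_normal_density x) * f j x \<partial>lborel)"
proof -
  \<comment> \<open>\<open>R\<close> relabels coordinates by the ordered copy. It preserves inner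
    products, so orthonormality and the projections are unaffected.\<close>
  define R :: "real^'n \<Rightarrow> real^'n ordered_index" where "R x = (\<chi> i. x $ Rep_ordered_index i)" for x
  have R: "R x \<bullet> R y = x \<bullet> y" for x y
    unfolding inner_vec_def R_def
    using sum.reindex_bij_betw [OF bij_Rep_ordered_index, of "\<lambda>i. x $ i \<bullet> y $ i"] by simp
  then have Rn: "norm (R x) = norm x" for x
    by (simp add: norm_eq_sqrt_inner)
  have "indep_vars (\<lambda>_. borel) (\<lambda>i \<omega>. R (\<epsilon> \<omega>) $ i) UNIV"
    using indep_vars_reindex [of Rep_ordered_index UNIV "\<lambda>_. borel" "\<lambda>i \<omega>. \<epsilon> \<omega> $ i"] indep
    by (simp add: R_def bij_is_inj bij_is_surj bij_Rep_ordered_index)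
  from nn_integral_std_normal_orthonormal_wellorder
    [where \<epsilon> = "\<lambda>\<omega>. R (\<epsilon> \<omega>)" and u = "\<lambda>j. R (u j)", OF this _ _ _ meas]
  show ?thesis
    using dist norm orth by (simp add: R Rn) (simp add: R_def)
qed

end

section \<open>Gaussian exponential integrals and the Chernoff bound\<close>

lemma nn_integral_normal_density:
  "0 < \<sigma> \<Longrightarrow> (\<integral>\<^sup>+x. ennreal (normal_density \<mu> \<sigma> x) \<partial>lborel) = 1"
  by (simp add: nn_integral_eq_integral)

text \<open>Tilting by \<open>exp (l * x\<^sup>2)\<close> gives a multiple of another centred normal
  density, with variance \<open>1 / (1 - 2*l)\<close>. Full and truncated exponential moments thus
  reduce to masses of normal densities.\<close>

lemma std_normal_density_exp_square:
  assumes "l < 1/2"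
  shows "std_normal_density x * exp (l * x\<^sup>2)
    = 1 / sqrt (1 - 2*l) * normal_density 0 (1 / sqrt (1 - 2*l)) x"
proof -
  have "- x\<^sup>2 / 2 + l * x\<^sup>2 = - x\<^sup>2 * (1 - 2*l) / 2"
    by (simp add: field_simps)
  then have "exp (- x\<^sup>2 / 2) * exp (l * x\<^sup>2) = exp (- (x\<^sup>2 * (1 - 2*l) / 2))"
    by (simp add: exp_add [symmetric])
  then show ?thesis
    using assms by (simp add: normal_density_def power_divide real_sqrt_divide field_simps)
qed

lemma nn_integral_std_normal_exp_square:
  assumes "l < 1/2"
  shows "(\<integral>\<^sup>+x. ennreal (std_normal_density x) * ennreal (exp (l * x\<^sup>2)) \<partial>lborel) = ennreal (1 / sqrt (1 - 2*l))"
proof -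
  let ?\<tau> = "1 / sqrt (1 - 2*l)"
  have "(\<integral>\<^sup>+x. ennreal (std_normal_density x) * ennreal (exp (l * x\<^sup>2)) \<partial>lborel)
      = (\<integral>\<^sup>+x. ennreal ?\<tau> * ennreal (normal_density 0 ?\<tau> x) \<partial>lborel)"
    using assms by (intro nn_integral_cong) (simp add: ennreal_mult' [symmetric] std_normal_density_exp_square)
  also have "\<dots> = ennreal ?\<tau>"
    using assms by (subst nn_integral_cmult) (auto simp: nn_integral_normal_density)
  finally show ?thesis .
qed

text \<open>If \<open>x\<close> lies beyond \<open>b\<close> on the same side of 0, where
  \<open>b\<close> is plus or minus \<open>sqrt a\<close>, then
  \<open>x\<^sup>2 - (x - b)\<^sup>2 = 2*b*x - a\<close> is at least \<open>a\<close>. Comparing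
  with densities shifted to these two points gives a tail bound by integration alone.\<close>

lemma normal_density_tail_le:
  assumes "0 < \<sigma>" "0 \<le> a" "a < x\<^sup>2"
  shows "normal_density 0 \<sigma> x
    \<le> exp (- a / (2 * \<sigma>\<^sup>2)) * (normal_density (sqrt a) \<sigma> x + normal_density (- sqrt a) \<sigma> x)"
proof -
  have *: "normal_density 0 \<sigma> x \<le> exp (- a / (2 * \<sigma>\<^sup>2)) * normal_density b \<sigma> x"
    if b: "b\<^sup>2 = a" "b * b \<le> b * x" for b
  proof -
    have "a + (x - b)\<^sup>2 \<le> x\<^sup>2"
      using b by (simp add: power2_eq_square algebra_simps)
    then have "- x\<^sup>2 / (2 * \<sigma>\<^sup>2) \<le> - a / (2 * \<sigma>\<^sup>2) + - (x - b)\<^sup>2 / (2 * \<sigma>\<^sup>2)"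
      using assms(1) by (simp add: field_simps)
    then have "exp (- x\<^sup>2 / (2 * \<sigma>\<^sup>2)) \<le> exp (- a / (2 * \<sigma>\<^sup>2)) * exp (- (x - b)\<^sup>2 / (2 * \<sigma>\<^sup>2))"
      by (simp add: exp_add [symmetric])
    then show ?thesis
      using assms(1) by (simp add: normal_density_def field_simps)
  qed
  have "sqrt a \<le> \<bar>x\<bar>"
    using assms by (metis less_imp_le real_sqrt_abs real_sqrt_le_mono)
  then consider "sqrt a \<le> x" | "sqrt a \<le> - x" by linarith
  then show ?thesis
  proof cases
    case 1
    then have "sqrt a * sqrt a \<le> sqrt a * x"
      using assms by (intro mult_left_mono) auto
    then have "normal_density 0 \<sigma> x \<le> exp (- a / (2 * \<sigma>\<^sup>2)) * normal_density (sqrt a) \<sigma> x"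
      using assms by (intro *) auto
    then show ?thesis by (simp add: distrib_left add_increasing2)
  next
    case 2
    then have "sqrt a * sqrt a \<le> sqrt a * (- x)"
      using assms by (intro mult_left_mono) auto
    then have "normal_density 0 \<sigma> x \<le> exp (- a / (2 * \<sigma>\<^sup>2)) * normal_density (- sqrt a) \<sigma> x"
      using assms by (intro *) auto
    then show ?thesis by (simp add: distrib_left add_increasing)
  qed
qed

text \<open>After tilting, the tail is dominated by two shifted normal densities of mass 1 each,
  whence the factor 2.\<close>

lemma nn_integral_std_normal_exp_square_tail:
  assumes l: "l < 1/2" and a: "0 \<le> a"
  shows "(\<integral>\<^sup>+x. ennreal (std_normal_density x) * ennreal (if a < x\<^sup>2 then exp (l * x\<^sup>2) else 0) \<partial>lborel)
    \<le> ennreal (2 / sqrt (1 - 2*l) * exp (- (1 - 2*l) * a / 2))"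
proof -
  define \<tau> where "\<tau> = 1 / sqrt (1 - 2*l)"
  have \<tau>: "\<tau> > 0" "\<tau>\<^sup>2 = 1 / (1 - 2*l)"
    using l by (auto simp: \<tau>_def power_divide)
  let ?c = "\<tau> * exp (- (1 - 2*l) * a / 2)"
  have pt: "std_normal_density x * (if a < x\<^sup>2 then exp (l * x\<^sup>2) else 0)
      \<le> ?c * (normal_density (sqrt a) \<tau> x + normal_density (- sqrt a) \<tau> x)" for x
  proof (cases "a < x\<^sup>2")
    case True
    have "std_normal_density x * exp (l * x\<^sup>2) = \<tau> * normal_density 0 \<tau> x"
      using std_normal_density_exp_square [OF l] by (simp add: \<tau>_def)
    also have "\<dots> \<le> \<tau> * (exp (- a / (2 * \<tau>\<^sup>2)) * (normal_density (sqrt a) \<tau> x + normal_density (- sqrt a) \<tau> x))"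
      using \<tau>(1) by (intro mult_left_mono normal_density_tail_le a True) auto
    also have "- a / (2 * \<tau>\<^sup>2) = - (1 - 2*l) * a / 2"
      using l by (simp add: \<tau> field_simps)
    finally show ?thesis using True by (simp add: mult.assoc)
  qed (use \<tau>(1) in \<open>simp add: add_nonneg_nonneg\<close>)
  have "(\<integral>\<^sup>+x. ennreal (std_normal_density x) * ennreal (if a < x\<^sup>2 then exp (l * x\<^sup>2) else 0) \<partial>lborel)
     \<le> (\<integral>\<^sup>+x. ennreal ?c * (ennreal (normal_density (sqrt a) \<tau> x) + ennreal (normal_density (- sqrt a) \<tau> x)) \<partial>lborel)"
    using pt \<tau>(1)
    by (intro nn_integral_mono)
       (simp add: ennreal_mult [symmetric] ennreal_plus [symmetric] del: ennreal_plus)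
  also have "\<dots> = ennreal ?c * 2"
    using \<tau>(1) by (subst nn_integral_cmult) (auto simp: nn_integral_add nn_integral_normal_density)
  also have "\<dots> = ennreal (2 / sqrt (1 - 2*l) * exp (- (1 - 2*l) * a / 2))"
    using \<tau>(1) by (simp add: ennreal_mult' [symmetric] \<tau>_def mult.commute flip: ennreal_numeral)
  finally show ?thesis .
qed

text \<open>The Chernoff parameter is absorbed into \<open>h\<close>, and \<open>exp k\<close>
  bounds the exponential moment of one coordinate. Independence enters only through the product
  formula for orthonormal directions.\<close>

lemma (in prob_space) chernoff_std_normal_orthonormal:
  fixes \<epsilon> :: "'a \<Rightarrow> real^'n" and u :: "'p::finite \<Rightarrow> real^'n"
  assumes indep: "indep_vars (\<lambda>_. borel) (\<lambda>i \<omega>. \<epsilon> \<omega> $ i) UNIV"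
    and dist: "\<And>i. distributed M lborel (\<lambda>\<omega>. \<epsilon> \<omega> $ i) std_normal_density"
    and norm: "\<And>j. norm (u j) = 1"
    and orth: "\<And>j k. j \<noteq> k \<Longrightarrow> u j \<bullet> u k = 0"
    and h [measurable]: "h \<in> borel_measurable borel"
    and k: "(\<integral>\<^sup>+x. ennreal (std_normal_density x) * ennreal (exp (h x)) \<partial>lborel) \<le> ennreal (exp k)"
  shows "prob {\<omega> \<in> space M. t \<le> (\<Sum>j\<in>J. h (u j \<bullet> \<epsilon> \<omega>))} \<le> exp (real (card J) * k - t)"
proof -
  have mi: "(\<lambda>\<omega>. \<epsilon> \<omega> $ i) \<in> borel_measurable M" for i
    using indep by (auto simp: indep_vars_def)
  then have [measurable]: "\<epsilon> \<in> borel_measurable M"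
    by (rule borel_measurable_vecI)
  \<comment> \<open>The constant 1 outside \<open>J\<close> lets the formula for the whole family
    handle a partial sum.\<close>
  define f where "f j x = (if j \<in> J then ennreal (exp (h x)) else 1)" for j x
  have split: "(\<Prod>j\<in>UNIV. if j \<in> J then H j else 1) = (\<Prod>j\<in>J. H j)" for H :: "'p \<Rightarrow> ennreal"
    by (simp add: prod.If_cases)
  have "(\<integral>\<^sup>+\<omega>. ennreal (exp (\<Sum>j\<in>J. h (u j \<bullet> \<epsilon> \<omega>))) \<partial>M) = (\<integral>\<^sup>+\<omega>. (\<Prod>j\<in>UNIV. f j (u j \<bullet> \<epsilon> \<omega>)) \<partial>M)"
    by (simp add: f_def split exp_sum prod_ennreal)
  also have "\<dots> = (\<Prod>j\<in>UNIV. \<integral>\<^sup>+x. ennreal (std_normal_density x) * f j x \<partial>lborel)"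
    by (rule nn_integral_std_normal_orthonormal [OF indep dist norm orth]) (auto simp: f_def [abs_def])
  also have "\<dots> = (\<Prod>j\<in>UNIV. if j \<in> J then (\<integral>\<^sup>+x. ennreal (std_normal_density x) * ennreal (exp (h x)) \<partial>lborel) else 1)"
    by (intro prod.cong) (auto simp: f_def nn_integral_normal_density)
  also have "\<dots> \<le> (\<Prod>j\<in>J. ennreal (exp k))"
    unfolding split by (intro prod_mono_ennreal k)
  also have "\<dots> = ennreal (exp (real (card J) * k))"
    by (simp add: ennreal_power exp_of_nat_mult [symmetric])
  finally have mgf: "(\<integral>\<^sup>+\<omega>. ennreal (exp (\<Sum>j\<in>J. h (u j \<bullet> \<epsilon> \<omega>))) \<partial>M) \<le> ennreal (exp (real (card J) * k))" .
  have "ennreal (prob {\<omega> \<in> space M. t \<le> (\<Sum>j\<in>J. h (u j \<bullet> \<epsilon> \<omega>))})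
      = emeasure M {\<omega> \<in> space M. t \<le> (\<Sum>j\<in>J. h (u j \<bullet> \<epsilon> \<omega>))}"
    by (rule emeasure_eq_measure [symmetric])
  also have "\<dots> \<le> ennreal (exp (- 1 * t)) * (\<integral>\<^sup>+\<omega>. ennreal (exp (1 * (\<Sum>j\<in>J. h (u j \<bullet> \<epsilon> \<omega>)))) * indicator (space M) \<omega> \<partial>M)"
    by (rule Chernoff_ineq_nn_integral_ge) auto
  also have "\<dots> = ennreal (exp (- t)) * (\<integral>\<^sup>+\<omega>. ennreal (exp (\<Sum>j\<in>J. h (u j \<bullet> \<epsilon> \<omega>))) \<partial>M)"
    by (auto intro!: arg_cong2 [where f = "(*)"] nn_integral_cong)
  also have "\<dots> \<le> ennreal (exp (- t)) * ennreal (exp (real (card J) * k))"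
    using mgf by (rule mult_left_mono) simp
  also have "\<dots> = ennreal (exp (real (card J) * k - t))"
    by (simp add: ennreal_mult [symmetric] exp_add [symmetric])
  finally show ?thesis by simp
qed

section \<open>The scalar shrinkage rule and its error\<close>

text \<open>In standardised units the variance estimate is \<open>g = u\<^sup>2 - 1\<close>,
  thresholded at \<open>z\<close>. The posterior mean \<open>u * g / (g + 1)\<close> then equals
  \<open>u - 1 / u\<close>.\<close>

definition shrink :: "real \<Rightarrow> real \<Rightarrow> real" where
  "shrink z u = (if 1 + z < u\<^sup>2 then u - 1 / u else 0)"

lemma shrink_measurable [measurable]: "shrink z \<in> borel_measurable borel"
  unfolding shrink_def [abs_def] by measurable

text \<open>In both branches the error has the form \<open>w - b\<close> with
  \<open>b\<^sup>2 \<le> 1 + z\<close>: \<open>b\<close> is \<open>1 / (\<theta> + w)\<close> above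
  the threshold and \<open>\<theta> + w\<close> below it.\<close>

lemma shrink_error_le:
  assumes "0 \<le> z"
  shows "(shrink z (\<theta> + w) - \<theta>)\<^sup>2 \<le> 2 * w\<^sup>2 + 2 * (1 + z)"
proof -
  have sq: "(a - b)\<^sup>2 \<le> 2 * a\<^sup>2 + 2 * b\<^sup>2" for a b :: real
    using zero_le_power2 [of "a + b"] by (simp add: power2_eq_square algebra_simps)
  show ?thesis
  proof (cases "1 + z < (\<theta> + w)\<^sup>2")
    case True
    then have "(1 / (\<theta> + w))\<^sup>2 \<le> 1 + z"
      using assms by (simp add: power_divide divide_le_eq) (smt (verit) mult_le_cancel_right1)
    then show ?thesis
      using sq [of w "1 / (\<theta> + w)"] True by (simp add: shrink_def)
  next
    case False
    then show ?thesis
      using sq [of w "\<theta> + w"] by (simp add: shrink_def)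
  qed
qed

text \<open>Above the threshold the square expands to \<open>w\<^sup>2 - 2 + 1 / w\<^sup>2\<close>,
  whose last term is at most 1.\<close>

lemma shrink_square_le:
  assumes "0 \<le> z"
  shows "(shrink z w)\<^sup>2 \<le> (if 1 + z < w\<^sup>2 then w\<^sup>2 - 1 else 0)"
proof (cases "1 + z < w\<^sup>2")
  case True
  then have "w \<noteq> 0" "1 / w\<^sup>2 \<le> 1"
    using assms by (auto simp: divide_le_eq)
  then have "(w - 1/w)\<^sup>2 \<le> w\<^sup>2 - 1"
    by (simp add: power2_diff power_divide)
  then show ?thesis using True by (simp add: shrink_def)
qed (simp add: shrink_def)

section \<open>Closed form of the estimator under orthogonal columns\<close>

lemma matrix_inv_diagonal:
  fixes d :: "'n::finite \<Rightarrow> real"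
  assumes "\<And>i. d i \<noteq> 0"
  shows "matrix_inv (\<chi> i k. if i = k then d i else 0) = (\<chi> i k. if i = k then 1 / d i else 0)" (is "matrix_inv ?A = ?B")
proof -
  have AB: "?A ** ?B = mat 1" and BA: "?B ** ?A = mat 1"
    using assms by (auto simp: matrix_matrix_mult_def mat_def vec_eq_iff if_distrib [of "\<lambda>x. x * _"]
        cong: if_cong)
  \<comment> \<open>\<open>matrix_inv\<close> is a choice operator; the explicit inverse witnesses
    that its specification can be met.\<close>
  have left: "matrix_inv ?A ** ?A = mat 1"
    unfolding matrix_inv_def by (rule someI2 [of _ ?B]) (use AB BA in auto)
  have "matrix_inv ?A = matrix_inv ?A ** (?A ** ?B)"
    by (simp add: AB)
  also have "\<dots> = ?B"
    by (simp add: matrix_mul_assoc left)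
  finally show ?thesis .
qed

text \<open>With orthogonal columns the Gram block is diagonal, so the whole encoded matrix is
  diagonal and can be inverted entrywise.\<close>

lemma post_mean_orthogonal:
  fixes X :: "real^'p^'n"
  assumes s: "0 < s2" and g: "\<And>j. 0 \<le> g $ j"
    and orth: "\<And>j k. j \<noteq> k \<Longrightarrow> column j X \<bullet> column k X = 0"
  shows "post_mean s2 X g Y $ j
    = (if g $ j = 0 then 0 else (column j X \<bullet> Y) / ((norm (column j X))\<^sup>2 + s2 / g $ j))"
proof -
  define d where "d j = (if g $ j = 0 then 1 else (norm (column j X))\<^sup>2 + s2 / g $ j)" for j
  have d0: "d j \<noteq> 0" for j
  proof (cases "g $ j = 0")
    case False
    then have "0 < s2 / g $ j"
      using s g[of j] by (simp add: less_le)
    then show ?thesis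
      using False by (simp add: d_def) (smt (verit) zero_le_power2)
  qed (simp add: d_def)
  have gram: "(transpose X ** X) $ j $ k = column j X \<bullet> column k X" for j k
    by (simp add: matrix_matrix_mult_def transpose_def column_def inner_vec_def)
  have tv: "(transpose X *v Y) $ j = column j X \<bullet> Y" for j
    by (simp add: matrix_vector_mult_def transpose_def column_def inner_vec_def)
  have A: "(\<chi> j k. if j \<in> {j. g $ j \<noteq> 0} \<and> k \<in> {j. g $ j \<noteq> 0}
                      then (transpose X ** X) $ j $ k + (if j = k then s2 / g $ j else 0)
                      else (if j = k then 1 else 0)) = (\<chi> j k. if j = k then d j else 0)"
    by (auto simp: vec_eq_iff gram d_def orth power2_norm_eq_inner)
  have diag: "((\<chi> i k. if i = k then 1 / d i else 0) *v b) $ j = b $ j / d j" for b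
    by (simp add: matrix_vector_mult_def if_distrib [of "\<lambda>x. x * _"] cong: if_cong)
  show ?thesis
    unfolding post_mean_def Let_def A matrix_inv_diagonal [of d, OF d0] diag tv
    by (simp add: d_def)
qed

text \<open>Everything is expressed through the standardised \<open>v\<close>: the variance estimate
  becomes a multiple of \<open>v\<^sup>2 - 1\<close>, the two thresholds combine into
  \<open>1 + z < v\<^sup>2\<close>, and the ridge denominator simplifies to
  \<open>r\<^sup>2 * v\<^sup>2 / (v\<^sup>2 - 1)\<close>.\<close>

lemma sbl_beta_tilde_orthogonal:
  fixes X :: "real^'p^'n"
  assumes \<sigma>: "0 < \<sigma>" and z: "0 \<le> z" and nz: "column j X \<noteq> 0"
    and orth: "\<And>j k. j \<noteq> k \<Longrightarrow> column j X \<bullet> column k X = 0"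
  shows "sbl_beta_tilde (\<sigma>\<^sup>2) z X Y $ j
    = \<sigma> / norm (column j X) * shrink z (column j X \<bullet> Y / (\<sigma> * norm (column j X)))"
proof -
  define r where "r = norm (column j X)"
  define v where "v = column j X \<bullet> Y / (\<sigma> * r)"
  define g where "g = sbl_gamma_tilde (\<sigma>\<^sup>2) z X Y"
  have r: "r > 0" using nz by (simp add: r_def)
  have cv: "column j X \<bullet> Y = \<sigma> * r * v"
    using r \<sigma> by (simp add: v_def)
  have hat: "sbl_gamma_hat (\<sigma>\<^sup>2) X Y $ j = (if 1 < v\<^sup>2 then \<sigma>\<^sup>2 * (v\<^sup>2 - 1) / r\<^sup>2 else 0)"
  proof -
    have "(\<sigma> * r * v)\<^sup>2 > \<sigma>\<^sup>2 * r\<^sup>2 \<longleftrightarrow> 1 < v\<^sup>2"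
      using r \<sigma> by (simp add: power_mult_distrib)
    moreover have "((\<sigma> * r * v)\<^sup>2 - \<sigma>\<^sup>2 * r\<^sup>2) / r^4 = \<sigma>\<^sup>2 * (v\<^sup>2 - 1) / r\<^sup>2"
      using r by (simp add: field_simps power2_eq_square power4_eq_xxxx)
    ultimately show ?thesis
      by (simp add: sbl_gamma_hat_def cv r_def [symmetric])
  qed
  have gj: "g $ j = (if 1 + z < v\<^sup>2 then \<sigma>\<^sup>2 * (v\<^sup>2 - 1) / r\<^sup>2 else 0)"
  proof -
    have "\<sigma>\<^sup>2 * (v\<^sup>2 - 1) / r\<^sup>2 > \<sigma>\<^sup>2 * z / r\<^sup>2 \<longleftrightarrow> 1 + z < v\<^sup>2"
      using r \<sigma> by (simp add: divide_less_cancel) (auto simp: algebra_simps)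
    moreover have "0 \<le> \<sigma>\<^sup>2 * z / r\<^sup>2"
      using z by simp
    ultimately show ?thesis
      using z by (auto simp: g_def sbl_gamma_tilde_def hat r_def [symmetric])
  qed
  have g0: "0 \<le> g $ k" for k
    using z by (auto simp: g_def sbl_gamma_tilde_def sbl_gamma_hat_def)
  have "sbl_beta_tilde (\<sigma>\<^sup>2) z X Y $ j = (if g $ j = 0 then 0 else (\<sigma> * r * v) / (r\<^sup>2 + \<sigma>\<^sup>2 / g $ j))"
    unfolding sbl_beta_tilde_def g_def [symmetric]
    using \<sigma> by (subst post_mean_orthogonal [OF _ g0 orth]) (auto simp: cv r_def [symmetric])
  also have "\<dots> = \<sigma> / r * shrink z v"
  proof (cases "1 + z < v\<^sup>2")
    case True
    then have v: "v\<^sup>2 > 1" "v \<noteq> 0" using z by auto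
    then have "r\<^sup>2 + \<sigma>\<^sup>2 / g $ j = r\<^sup>2 * v\<^sup>2 / (v\<^sup>2 - 1)"
      using True r \<sigma> by (simp add: gj field_simps)
    moreover have "g $ j \<noteq> 0"
      using v True r \<sigma> by (simp add: gj)
    moreover have "\<sigma> * r * v / (r\<^sup>2 * v\<^sup>2 / (v\<^sup>2 - 1)) = \<sigma> / r * (v - 1 / v)"
      using v r by (simp add: field_simps power2_eq_square)
    ultimately show ?thesis
      using True by (simp add: shrink_def)
  qed (simp add: gj shrink_def)
  finally show ?thesis by (simp add: v_def r_def)
qed

section \<open>Exponential moment of the exceedances off the support\<close>

text \<open>The exponential equals 1 except on the exceedance set, where the truncated moment with
  \<open>l = 1 / z\<close> and \<open>a = 1 + z\<close> applies. The bound on \<open>z\<close> gives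
  \<open>1 - 2/z \<ge> 1/4\<close>, so the prefactor \<open>2 / sqrt (1 - 2/z)\<close> is at most
  4.\<close>

lemma nn_integral_std_normal_exp_exceedance:
  assumes z: "8/3 \<le> z"
  shows "(\<integral>\<^sup>+x. ennreal (std_normal_density x) * ennreal (exp ((if 1 + z < x\<^sup>2 then x\<^sup>2 - 1 else 0) / z)) \<partial>lborel)
    \<le> ennreal (exp (4 * exp (1/2 - z/2)))"
proof -
  let ?l = "1 / z"
  define T where "T x = (if 1 + z < x\<^sup>2 then exp (?l * x\<^sup>2) else 0)" for x
  have [simp]: "0 \<le> T x" for x
    by (simp add: T_def)
  have [measurable]: "T \<in> borel_measurable borel"
    unfolding T_def [abs_def] by measurable
  have l: "?l \<le> 3/8"
    using z by (simp add: divide_le_eq)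
  have "sqrt (1/4) \<le> sqrt (1 - 2 * ?l)"
    using l by (intro real_sqrt_le_mono) simp
  then have q: "1/2 \<le> sqrt (1 - 2 * ?l)"
    by (simp add: real_sqrt_divide)
  have pt: "exp ((if 1 + z < x\<^sup>2 then x\<^sup>2 - 1 else 0) / z) \<le> 1 + exp (- ?l) * T x" for x
    using z by (auto simp: T_def exp_add [symmetric] diff_divide_distrib)
  have "(\<integral>\<^sup>+x. ennreal (std_normal_density x) * ennreal (exp ((if 1 + z < x\<^sup>2 then x\<^sup>2 - 1 else 0) / z)) \<partial>lborel)
     \<le> (\<integral>\<^sup>+x. ennreal (std_normal_density x) + ennreal (exp (- ?l)) * (ennreal (std_normal_density x) * ennreal (T x)) \<partial>lborel)"
  proof (rule nn_integral_mono)
    fix x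
    have "std_normal_density x * exp ((if 1 + z < x\<^sup>2 then x\<^sup>2 - 1 else 0) / z)
        \<le> std_normal_density x * (1 + exp (- ?l) * T x)"
      using pt by (rule mult_left_mono) simp
    also have "\<dots> = std_normal_density x + exp (- ?l) * (std_normal_density x * T x)"
      by (simp add: algebra_simps)
    finally show "ennreal (std_normal_density x) * ennreal (exp ((if 1 + z < x\<^sup>2 then x\<^sup>2 - 1 else 0) / z))
      \<le> ennreal (std_normal_density x) + ennreal (exp (- ?l)) * (ennreal (std_normal_density x) * ennreal (T x))"
      by (simp add: ennreal_mult [symmetric] ennreal_plus [symmetric] del: ennreal_plus split del: if_split)
  qed
  also have "\<dots> = 1 + ennreal (exp (- ?l)) * (\<integral>\<^sup>+x. ennreal (std_normal_density x) * ennreal (T x) \<partial>lborel)"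
    by (simp add: nn_integral_add nn_integral_cmult nn_integral_normal_density)
  also have "\<dots> \<le> 1 + ennreal (exp (- ?l)) * ennreal (2 / sqrt (1 - 2 * ?l) * exp (- (1 - 2 * ?l) * (1 + z) / 2))"
    unfolding T_def using l z by (intro add_left_mono mult_left_mono nn_integral_std_normal_exp_square_tail) auto
  also have "\<dots> = ennreal (1 + exp (- ?l) * (2 / sqrt (1 - 2 * ?l) * exp (- (1 - 2 * ?l) * (1 + z) / 2)))"
  proof -
    have "1 + ennreal a * ennreal b = ennreal (1 + a * b)" if "0 \<le> a" "0 \<le> b" for a b
      using that by (simp add: ennreal_mult)
    from this [of "exp (- ?l)" "2 / sqrt (1 - 2 * ?l) * exp (- (1 - 2 * ?l) * (1 + z) / 2)"]
    show ?thesis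
      using q by (metis divide_nonneg_nonneg exp_ge_zero mult_nonneg_nonneg order_trans zero_le_divide_1_iff zero_le_numeral)
  qed
  also have "exp (- ?l) * (2 / sqrt (1 - 2 * ?l) * exp (- (1 - 2 * ?l) * (1 + z) / 2))
      = 2 / sqrt (1 - 2 * ?l) * exp (1/2 - z/2)"
  proof -
    \<comment> \<open>With \<open>l * z = 1\<close> the terms in \<open>l\<close> cancel, including
      the one from the \<open>- 1\<close> in the exceedance.\<close>
    have "- ?l + - (1 - 2 * ?l) * (1 + z) / 2 = 1/2 - z/2"
      using z by (simp add: field_simps)
    then have "exp (- ?l) * exp (- (1 - 2 * ?l) * (1 + z) / 2) = exp (1/2 - z/2)"
      by (simp add: exp_add [symmetric])
    then show ?thesis by (simp add: mult.left_commute)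
  qed
  also have "ennreal (1 + 2 / sqrt (1 - 2 * ?l) * exp (1/2 - z/2)) \<le> ennreal (1 + 4 * exp (1/2 - z/2))"
  proof (intro ennreal_leI add_left_mono mult_right_mono)
    show "2 / sqrt (1 - 2 * ?l) \<le> 4"
      using q by (subst pos_divide_le_eq) linarith+
  qed simp
  also have "\<dots> \<le> ennreal (exp (4 * exp (1/2 - z/2)))"
    by (intro ennreal_leI exp_ge_add_one_self)
  finally show ?thesis .
qed

text \<open>The target \<open>- s\<close> uses up the part \<open>s\<close> of the subtracted term.
  What remains of it is at least \<open>13.2 / c0\<close>, which also bounds the moment term. Both
  estimates decay like \<open>1 / c0\<close>, so they balance uniformly in
  \<open>c0 > 2\<close>.\<close>

lemma exceedance_exponent_le:
  fixes c0 L s m :: real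
  assumes c0: "2 < c0" and L: "4/3 \<le> L" and s: "3 \<le> s" and m: "m \<le> exp L"
  shows "m * (4 * exp (1/2 - c0 * L / 2)) - s * (c0 * L + 8 * L - 2 - 4 * ln 2) / (c0 * L) \<le> - s"
proof -
  have "m * (4 * exp (1/2 - c0 * L / 2)) \<le> exp L * (4 * exp (1/2 - c0 * L / 2))"
    using m by (rule mult_right_mono) simp
  also have "\<dots> = 4 * exp (1/2) * exp (- ((c0 - 2) * L / 2))"
    by (simp add: exp_add [symmetric] algebra_simps diff_divide_distrib)
  also have "\<dots> \<le> 4 * 1.65 * (2 / c0)"
  proof (intro mult_mono)
    \<comment> \<open>The constant works because \<open>1.65\<^sup>2 = 2.7225\<close> exceeds 2.72,
      and \<open>4 * 1.65 * 2 = 13.2\<close>.\<close>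
    have "(exp (1/2::real))\<^sup>2 \<le> 1.65\<^sup>2"
      using e_less_272 by (simp add: power2_eq_square exp_add [symmetric])
    then show "exp (1/2::real) \<le> 1.65"
      by (rule power2_le_imp_le) simp
    have "c0 / 2 \<le> 1 + (c0 - 2) * L / 2"
      using mult_left_mono [of 1 L "c0 - 2"] c0 L by (simp add: field_simps)
    also have "\<dots> \<le> exp ((c0 - 2) * L / 2)"
      by (rule exp_ge_add_one_self)
    finally show "exp (- ((c0 - 2) * L / 2)) \<le> 2 / c0"
      using c0 by (simp add: exp_minus field_simps)
  qed auto
  finally have 1: "m * (4 * exp (1/2 - c0 * L / 2)) \<le> 13.2 / c0"
    by simp
  have "ln 2 \<le> (25/36 :: real)" by (rule ln2_le_25_over_36)
  \<comment> \<open>At \<open>L = 4/3\<close> the slack \<open>3.6 * L\<close> is 4.8, just above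
    \<open>2 + 4 * (25/36)\<close>. With \<open>s \<ge> 3\<close> this gives
    \<open>3 * 4.4 = 13.2\<close>.\<close>
  then have "4.4 * L \<le> 8 * L - 2 - 4 * ln 2"
    using L by simp
  then have "3 * (4.4 * L) \<le> s * (8 * L - 2 - 4 * ln 2)"
    using s L by (intro mult_mono) auto
  then have "13.2 * L / (c0 * L) \<le> s * (8 * L - 2 - 4 * ln 2) / (c0 * L)"
    using c0 L by (intro divide_right_mono) auto
  then have "13.2 / c0 \<le> s * (8 * L - 2 - 4 * ln 2) / (c0 * L)"
    using L by simp
  moreover have "s * (c0 * L + 8 * L - 2 - 4 * ln 2) / (c0 * L) = s + s * (8 * L - 2 - 4 * ln 2) / (c0 * L)"
    using c0 L by (simp add: field_simps)
  ultimately show ?thesis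
    using 1 by linarith
qed

section \<open>The high-probability error bound\<close>

theorem theorem1:
  fixes M :: "'a measure"
    and \<epsilon> :: "'a \<Rightarrow> real^'n"
    and X :: "real^'p^'n"
    and \<beta> :: "real^'p"
    and \<sigma> c0 :: real
  assumes "prob_space M"
    and "\<sigma> > 0"
    and "prob_space.indep_vars M (\<lambda>_. borel) (\<lambda>i \<omega>. \<epsilon> \<omega> $ i) UNIV"
    and "\<And>i. distributed M lborel (\<lambda>\<omega>. \<epsilon> \<omega> $ i) (\<lambda>x. ennreal (normal_density 0 \<sigma> x))"
    and "\<And>j. column j X \<noteq> 0"
    and "\<And>j k. j \<noteq> k \<Longrightarrow> column j X \<bullet> column k X = 0"
    and "ln (real (card {j. \<beta> $ j \<noteq> 0})) \<ge> 1"
    and "c0 > 2"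
  shows "let n = real CARD('n); p = real CARD('p); s = real (card {j. \<beta> $ j \<noteq> 0});
             \<sigma>2 = \<sigma>^2; zstar = c0 * ln p;
             c = Min ((\<lambda>j. (norm (column j X))^2 / n) ` UNIV);
             Mc = 4 * (2 + c0) / c
         in measure M {\<omega> \<in> space M.
               (norm (sbl_beta_tilde \<sigma>2 zstar X (X *v \<beta> + \<epsilon> \<omega>) - \<beta>))^2
                 \<le> Mc * \<sigma>2 * s * ln p / n}
            \<ge> 1 - p powr (- c0 * s / 8) - exp (- s)"
proof -
  interpret prob_space M by fact
  note \<sigma> = \<open>\<sigma> > 0\<close> and nz = assms(5) and orth = assms(6) and c0 = \<open>c0 > 2\<close>
  define n where "n = real CARD('n)"
  define p where "p = real CARD('p)"
  define S where "S = {j. \<beta> $ j \<noteq> 0}"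
  define s where "s = real (card S)"
  define L where "L = ln p"
  define z where "z = c0 * L"
  define c where "c = Min ((\<lambda>j. (norm (column j X))\<^sup>2 / n) ` UNIV)"
  define r where "r j = norm (column j X)" for j
  define u where "u j = column j X /\<^sub>R r j" for j
  define W where "W j \<omega> = u j \<bullet> (\<epsilon> \<omega> /\<^sub>R \<sigma>)" for j \<omega>
  define \<theta> where "\<theta> j = r j * \<beta> $ j / \<sigma>" for j
  define e where "e j \<omega> = shrink z (\<theta> j + W j \<omega>) - \<theta> j" for j \<omega>
  define q where "q w = (if 1 + z < w\<^sup>2 then w\<^sup>2 - 1 else 0)" for w :: real
  let ?Y = "\<lambda>\<omega>. X *v \<beta> + \<epsilon> \<omega>"

  have n: "n > 0" by (simp add: n_def)
  have r: "r j > 0" for j using nz by (simp add: r_def)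
  have lns: "1 \<le> ln s" using assms(7) by (simp add: s_def S_def)
  \<comment> \<open>The value \<open>s = 0\<close> is excluded because \<open>ln 0 = 0\<close> by
    convention.\<close>
  have s0: "s > 0"
    using lns by (cases "s = 0") (auto simp: s_def)
  \<comment> \<open>Since \<open>ln 2 < 1\<close>, the integer \<open>s\<close> exceeds 2.\<close>
  have s3: "3 \<le> s"
  proof -
    have "2 < s"
      using lns s0 ln_2_less_1 by (metis less_le_trans linorder_not_le ln_le_cancel_iff not_less zero_less_numeral)
    then show ?thesis by (simp add: s_def)
  qed
  have sp: "s \<le> p"
    unfolding s_def p_def by (intro of_nat_mono card_mono) auto
  have L1: "1 \<le> L"
    using lns sp s0 unfolding L_def by (smt (verit) ln_le_cancel_iff)
  have z2: "2 \<le> z"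
    using c0 L1 mult_mono [of 2 c0 1 L] by (simp add: z_def)
  have ln2: "ln 2 \<le> (25/36 :: real)" by (rule ln2_le_25_over_36)
  have cn: "0 < c * n" "c * n \<le> (r j)\<^sup>2" for j
  proof -
    have "c \<in> (\<lambda>j. (norm (column j X))\<^sup>2 / n) ` UNIV"
      unfolding c_def by (rule Min_in) auto
    then show "0 < c * n" using nz n by auto
    have "c \<le> (norm (column j X))\<^sup>2 / n"
      unfolding c_def by (rule Min_le) auto
    then show "c * n \<le> (r j)\<^sup>2" using n by (simp add: r_def field_simps)
  qed

  have indep: "indep_vars (\<lambda>_. borel) (\<lambda>i \<omega>. (\<epsilon> \<omega> /\<^sub>R \<sigma>) $ i) UNIV"
    using indep_vars_compose2 [OF assms(3), of "\<lambda>_ x. inverse \<sigma> * x" "\<lambda>_. borel"] by simp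
  have dist: "distributed M lborel (\<lambda>\<omega>. (\<epsilon> \<omega> /\<^sub>R \<sigma>) $ i) std_normal_density" for i
    using assms(4) [of i] \<sigma> by (subst (asm) normal_standard_normal_convert) (auto simp: divide_inverse mult.commute)
  have unorm: "norm (u j) = 1" for j
    using r[of j] by (simp add: u_def r_def)
  have uorth: "u j \<bullet> u k = 0" if "j \<noteq> k" for j k
    using orth [OF that] by (simp add: u_def)
  have mW [measurable]: "W j \<in> borel_measurable M" for j
  proof -
    have "(\<lambda>\<omega>. (\<epsilon> \<omega> /\<^sub>R \<sigma>) $ i) \<in> borel_measurable M" for i
      using indep by (auto simp: indep_vars_def)
    then have "(\<lambda>\<omega>. \<epsilon> \<omega> /\<^sub>R \<sigma>) \<in> borel_measurable M"
      by (rule borel_measurable_vecI)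
    then show ?thesis
      unfolding W_def [abs_def] by (intro borel_measurable_inner) auto
  qed
  have mq [measurable]: "q \<in> borel_measurable borel"
    unfolding q_def [abs_def] by measurable

  have err: "(sbl_beta_tilde (\<sigma>\<^sup>2) z X (?Y \<omega>) - \<beta>) $ j = \<sigma> / r j * e j \<omega>" for j \<omega>
  proof -
    have "column j X \<bullet> (X *v \<beta>) = (\<Sum>k\<in>UNIV. \<beta> $ k * (column j X \<bullet> column k X))"
      by (simp add: matrix_mult_sum inner_sum_right scalar_mult_eq_scaleR)
    also have "\<dots> = (\<Sum>k\<in>UNIV. if k = j then \<beta> $ j * (r j)\<^sup>2 else 0)"
      by (rule sum.cong) (auto simp: orth r_def power2_norm_eq_inner)
    finally have "column j X \<bullet> (X *v \<beta>) = \<beta> $ j * (r j)\<^sup>2"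
      by simp
    then have "column j X \<bullet> ?Y \<omega> / (\<sigma> * r j) = \<theta> j + W j \<omega>"
      using r[of j] \<sigma> by (simp add: inner_add_right \<theta>_def W_def u_def field_simps power2_eq_square)
    then have "sbl_beta_tilde (\<sigma>\<^sup>2) z X (?Y \<omega>) $ j = \<sigma> / r j * shrink z (\<theta> j + W j \<omega>)"
      using sbl_beta_tilde_orthogonal [OF \<sigma> _ nz orth, where z = z and j = j and Y = "?Y \<omega>"] z2
      by (simp add: r_def [symmetric])
    moreover have "\<sigma> / r j * \<theta> j = \<beta> $ j"
      using r[of j] \<sigma> by (simp add: \<theta>_def)
    ultimately show ?thesis
      by (simp add: e_def right_diff_distrib)
  qed
  have norm_err: "(norm (sbl_beta_tilde (\<sigma>\<^sup>2) z X (?Y \<omega>) - \<beta>))\<^sup>2 = (\<Sum>j\<in>UNIV. (\<sigma> / r j * e j \<omega>)\<^sup>2)" for \<omega>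
    by (simp only: norm_vec_def L2_set_def err real_norm_def power2_abs) (simp add: sum_nonneg)

  \<comment> \<open>The event is written with the coordinate sum of \<open>norm_err\<close>, from
    which its measurability is immediate.\<close>
  define E where "E = {\<omega> \<in> space M. (\<Sum>j\<in>UNIV. (\<sigma> / r j * e j \<omega>)\<^sup>2) \<le> 4 * (2 + c0) / c * \<sigma>\<^sup>2 * s * L / n}"
  \<comment> \<open>At parameter 1/4 each coordinate contributes \<open>ln 2 / 2\<close> to the log
    moment. The second summand of \<open>t1\<close> cancels this and leaves the exponent
    \<open>- s * z / 8\<close>.\<close>
  define t1 where "t1 = s * (z / 8 + ln 2 / 2)"
  \<comment> \<open>This is the total budget \<open>4 * (2 + c0) * s * L\<close> minus the support's
    share \<open>8 * t1 + 2 * s * (1 + z)\<close>, divided by \<open>z\<close> for the Chernoff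
    parameter \<open>1 / z\<close>.\<close>
  define t2 where "t2 = s * (c0 * L + 8 * L - 2 - 4 * ln 2) / (c0 * L)"
  define E1 where "E1 = {\<omega> \<in> space M. t1 \<le> (\<Sum>j\<in>S. 1/4 * (W j \<omega>)\<^sup>2)}"
  define E2 where "E2 = {\<omega> \<in> space M. t2 \<le> (\<Sum>j\<in>-S. q (W j \<omega>) / z)}"
  have [measurable]: "E \<in> events" "E1 \<in> events" "E2 \<in> events"
    unfolding E_def E1_def E2_def e_def by measurable

  have "prob E1 \<le> exp (real (card S) * (ln 2 / 2) - t1)"
    unfolding E1_def W_def
  proof (rule chernoff_std_normal_orthonormal [OF indep dist unorm uorth])
    have "1 / sqrt (1 - 2 * (1/4)) = exp (ln 2 / 2)"
      by (simp add: real_sqrt_divide powr_half_sqrt [symmetric] powr_def)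
    then show "(\<integral>\<^sup>+x. ennreal (std_normal_density x) * ennreal (exp (1/4 * x\<^sup>2)) \<partial>lborel) \<le> ennreal (exp (ln 2 / 2))"
      by (subst nn_integral_std_normal_exp_square) auto
  qed auto
  also have "\<dots> = p powr (- c0 * s / 8)"
    using s0 sp by (simp add: t1_def s_def [symmetric] powr_def z_def L_def algebra_simps)
  finally have P1: "prob E1 \<le> p powr (- c0 * s / 8)" .

  have zt2: "z * t2 = s * (z + 8 * L - 2 - 4 * ln 2)"
    using z2 by (simp add: t2_def flip: z_def)
  have P2: "prob E2 \<le> exp (- s)"
  \<comment> \<open>With full support the sum is empty and \<open>t2 > 0\<close> rules out the
    event. Otherwise \<open>p\<close> exceeds \<open>s \<ge> 3\<close>, hence
    \<open>p \<ge> 4\<close>, which supplies \<open>L \<ge> 4/3\<close> and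
    \<open>z \<ge> 8/3\<close>.\<close>
  proof (cases "- S = {}")
    case True
    have "0 < z * t2"
      unfolding zt2 using s0 z2 L1 ln2 by (intro mult_pos_pos) auto
    then have "0 < t2"
      using z2 by (simp add: zero_less_mult_iff)
    then have "E2 = {}" by (simp add: E2_def True)
    then show ?thesis by simp
  next
    case False
    then have "card S < CARD('p)"
      by (intro psubset_card_mono) auto
    then have p4: "4 \<le> p"
      using s3 by (simp add: s_def p_def)
    have "4/3 \<le> ln (2^2 :: real)"
      using ln2_ge_two_thirds by (subst ln_realpow) auto
    also have "\<dots> \<le> L"
      unfolding L_def using p4 by (subst ln_le_cancel_iff) auto
    finally have L: "4/3 \<le> L" .
    have z: "8/3 \<le> z"
      using c0 L mult_mono [of 2 c0 "4/3" L] by (simp add: z_def)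
    have "prob E2 \<le> exp (real (card (- S)) * (4 * exp (1/2 - z/2)) - t2)"
      unfolding E2_def W_def
    proof (rule chernoff_std_normal_orthonormal [OF indep dist unorm uorth])
      show "(\<integral>\<^sup>+x. ennreal (std_normal_density x) * ennreal (exp (q x / z)) \<partial>lborel) \<le> ennreal (exp (4 * exp (1/2 - z/2)))"
        unfolding q_def by (rule nn_integral_std_normal_exp_exceedance [OF z])
    qed auto
    also have "\<dots> \<le> exp (- s)"
    proof -
      have "real (card (- S)) \<le> p"
        unfolding p_def by (intro of_nat_mono card_mono) auto
      also have "p = exp L" using p4 by (simp add: L_def)
      finally show ?thesis
        using exceedance_exponent_le [OF c0 L s3] by (simp add: t2_def z_def)
    qed
    finally show ?thesis .
  qed

  have "space M - E \<subseteq> E1 \<union> E2"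
  proof
    fix \<omega> assume \<omega>: "\<omega> \<in> space M - E"
    show "\<omega> \<in> E1 \<union> E2"
    proof (rule ccontr)
      assume "\<omega> \<notin> E1 \<union> E2"
      then have "(\<Sum>j\<in>S. 1/4 * (W j \<omega>)\<^sup>2) < t1" and "(\<Sum>j\<in>-S. q (W j \<omega>) / z) < t2"
        using \<omega> by (auto simp: E1_def E2_def)
      then have b1: "(\<Sum>j\<in>S. (W j \<omega>)\<^sup>2) \<le> 4 * t1" and b2: "(\<Sum>j\<in>-S. q (W j \<omega>)) \<le> z * t2"
        using z2 by (auto simp: sum_distrib_left [symmetric] sum_divide_distrib [symmetric] field_simps)
      have "(\<Sum>j\<in>UNIV. (e j \<omega>)\<^sup>2) = (\<Sum>j\<in>S. (e j \<omega>)\<^sup>2) + (\<Sum>j\<in>-S. (e j \<omega>)\<^sup>2)"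
        by (subst sum.union_disjoint [symmetric]) auto
      also have "\<dots> \<le> (\<Sum>j\<in>S. 2 * (W j \<omega>)\<^sup>2 + 2 * (1 + z)) + (\<Sum>j\<in>-S. q (W j \<omega>))"
      proof (intro add_mono sum_mono)
        show "(e j \<omega>)\<^sup>2 \<le> 2 * (W j \<omega>)\<^sup>2 + 2 * (1 + z)" for j
          unfolding e_def using z2 by (intro shrink_error_le) simp
        \<comment> \<open>Off the support \<open>\<theta> j = 0\<close>, so the error is the
          shrunken noise itself.\<close>
        show "(e j \<omega>)\<^sup>2 \<le> q (W j \<omega>)" if "j \<in> - S" for j
          using that shrink_square_le [of z "W j \<omega>"] z2 by (simp add: e_def \<theta>_def S_def q_def)
      qed
      also have "\<dots> = 2 * (\<Sum>j\<in>S. (W j \<omega>)\<^sup>2) + s * (2 * (1 + z)) + (\<Sum>j\<in>-S. q (W j \<omega>))"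
        by (simp add: sum.distrib sum_distrib_left s_def)
      also have "\<dots> \<le> 2 * (4 * t1) + s * (2 * (1 + z)) + z * t2"
        using b1 b2 by simp
      \<comment> \<open>The budget is used exactly: the terms in \<open>s\<close> and
        \<open>s * ln 2\<close> cancel, leaving \<open>4 * s * z + 8 * s * L\<close>.\<close>
      also have "\<dots> = 4 * (2 + c0) * s * L"
        unfolding zt2 by (simp add: t1_def z_def algebra_simps)
      finally have tot: "(\<Sum>j\<in>UNIV. (e j \<omega>)\<^sup>2) \<le> 4 * (2 + c0) * s * L" .
      \<comment> \<open>Every squared column norm is replaced by the smallest one,
        \<open>c * n\<close>.\<close>
      have "(\<Sum>j\<in>UNIV. (\<sigma> / r j * e j \<omega>)\<^sup>2) \<le> (\<Sum>j\<in>UNIV. \<sigma>\<^sup>2 / (c * n) * (e j \<omega>)\<^sup>2)"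
        unfolding power_mult_distrib power_divide
        using cn by (intro sum_mono mult_right_mono divide_left_mono) (auto intro: mult_pos_pos less_le_trans)
      also have "\<dots> \<le> \<sigma>\<^sup>2 / (c * n) * (4 * (2 + c0) * s * L)"
        unfolding sum_distrib_left [symmetric] using tot cn(1) by (intro mult_left_mono) auto
      also have "\<dots> = 4 * (2 + c0) / c * \<sigma>\<^sup>2 * s * L / n"
        by simp
      finally show False
        using \<omega> by (simp add: E_def)
    qed
  qed
  then have "prob (space M - E) \<le> prob (E1 \<union> E2)"
    by (intro finite_measure_mono) auto
  also have "\<dots> \<le> prob E1 + prob E2"
    by (rule measure_Un_le) auto
  finally have "1 - p powr (- c0 * s / 8) - exp (- s) \<le> prob E"
    using P1 P2 by (simp add: prob_compl)
  then show ?thesis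
    unfolding Let_def n_def [symmetric] p_def [symmetric] S_def [symmetric]
      s_def [symmetric] L_def [symmetric] z_def [symmetric] c_def [symmetric]
    by (simp only: norm_err E_def)
qed

end
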